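(* Let $p,n\ge 1$ and let $X_1,\dots,X_n$ be independent and identically distributed random variables on $\mathbb{R}^p$ that are symmetric about $\mu\in\mathbb{R}^p$ with respect to one of the following notions: spherical, elliptical or central symmetry. Then for any $\lambda_1,\dots,\lambda_n\in\mathbb{R}$ and $b\in\mathbb{R}^p$, the random variable $\sum_{i=1}^n\lambda_iX_i+b$ is symmetric about $\left(\sum_{i=1}^n\lambda_i\right)\mu+b$ with respect to the same notion of symmetry.
   Context: A random variable $X$ in $\mathbb{R}^p$ is spherically symmetric about $\mu\in\mathbb{R}^p$ if $X-\mu$ and $U(X-\mu)$ are identically distributed for every orthonormal (orthogonal) $p\times p$ matrix $U$. It is elliptically symmetric about $\mu$ if there exists a nonsingular $p\times p$ matrix $V$ such that $VX$ is spherically symmetric about $V\mu$. It is centrally symmetric about $\mu$ if $X-\mu$ and $\mu-X$ are identically distributed. *)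

theory Defs
  imports "HOL-Probability.Probability"
begin

(* Measurability is part of the definition: distr carries no information about
   a non-measurable function. As a consequence, each symmetry notion below entails
   that X itself is a random variable (for the spherical one, take U = mat 1). *)
definition identically_distributed ::
  "'s measure \<Rightarrow> ('s \<Rightarrow> 'b::topological_space) \<Rightarrow> ('s \<Rightarrow> 'b) \<Rightarrow> bool" where
  "identically_distributed M X Y \<longleftrightarrow>
     X \<in> borel_measurable M \<and> Y \<in> borel_measurable M \<and> distr M borel X = distr M borel Y"

definition spherically_symmetric ::
  "'s measure \<Rightarrow> ('s \<Rightarrow> real ^ 'p) \<Rightarrow> real ^ 'p \<Rightarrow> bool" where
  "spherically_symmetric M X \<mu> \<longleftrightarrow>
     (\<forall>U :: real ^ 'p ^ 'p. orthogonal_matrix U \<longrightarrow>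
        identically_distributed M (\<lambda>\<omega>. X \<omega> - \<mu>) (\<lambda>\<omega>. U *v (X \<omega> - \<mu>)))"

definition elliptically_symmetric ::
  "'s measure \<Rightarrow> ('s \<Rightarrow> real ^ 'p) \<Rightarrow> real ^ 'p \<Rightarrow> bool" where
  "elliptically_symmetric M X \<mu> \<longleftrightarrow>
     (\<exists>V :: real ^ 'p ^ 'p. invertible V \<and> spherically_symmetric M (\<lambda>\<omega>. V *v X \<omega>) (V *v \<mu>))"

definition centrally_symmetric ::
  "'s measure \<Rightarrow> ('s \<Rightarrow> real ^ 'p) \<Rightarrow> real ^ 'p \<Rightarrow> bool" where
  "centrally_symmetric M X \<mu> \<longleftrightarrow>
     identically_distributed M (\<lambda>\<omega>. X \<omega> - \<mu>) (\<lambda>\<omega>. \<mu> - X \<omega>)"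

end

theory Submission
  imports Defs
begin

text \<open>
  Spherical and central symmetry about \<open>\<mu>\<close> both say that the law of \<open>X - \<mu>\<close> is invariant under
  certain linear maps: the orthogonal ones, or \<open>x \<mapsto> - x\<close> alone. The centred linear combination is
  \<open>\<Sum>i. \<lambda>\<^sub>i (X\<^sub>i - \<mu>)\<close>, and a linear \<open>f\<close> sends it to \<open>\<Sum>i. \<lambda>\<^sub>i f (X\<^sub>i - \<mu>)\<close>.
  Independence determines the joint law of a family from its marginals, and \<open>f\<close> preserves each
  marginal, so it preserves the joint law of \<open>(X\<^sub>i - \<mu>)\<^sub>i\<close> when it acts on all components
  simultaneously. Hence it preserves the law of the combination
  (\<open>linear_combination_invariant\<close>).

  Elliptical symmetry is spherical symmetry of \<open>V X\<^sub>i\<close> for some invertible \<open>V\<close>. A priori \<open>V\<close>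
  depends on \<open>i\<close>, but spherical symmetry is a property of the law, so the identity of the laws
  allows one \<open>V\<close> to serve for all \<open>i\<close>. Since \<open>V\<close> is linear, the spherical case applied to the
  family \<open>V X\<^sub>i\<close> then finishes the proof.
\<close>

lemma identically_distributed_compose:
  assumes "identically_distributed M X Y" and g: "g \<in> borel_measurable borel"
  shows "identically_distributed M (\<lambda>\<omega>. g (X \<omega>)) (\<lambda>\<omega>. g (Y \<omega>))"
proof -
  have X: "X \<in> borel_measurable M" and Y: "Y \<in> borel_measurable M"
    and eq: "distr M borel X = distr M borel Y"
    using assms(1) by (auto simp: identically_distributed_def)
  have "distr M borel (\<lambda>\<omega>. g (X \<omega>)) = distr (distr M borel X) borel g"
    using X g by (simp add: distr_distr o_def)
  also have "\<dots> = distr M borel (\<lambda>\<omega>. g (Y \<omega>))"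
    unfolding eq using Y g by (simp add: distr_distr o_def)
  finally show ?thesis
    using X Y g by (simp add: identically_distributed_def)
qed

lemma borel_measurable_linear:
  fixes f :: "'a::euclidean_space \<Rightarrow> 'b::real_normed_vector"
  assumes "linear f"
  shows "f \<in> borel_measurable borel"
  using assms by (intro borel_measurable_continuous_onI linear_continuous_on)
    (simp add: linear_conv_bounded_linear)

text \<open>
  Both joint laws are the product of the same marginals, and a linear combination is a measurable
  function of the joint vector.
\<close>

lemma (in prob_space) identically_distributed_linear_combination:
  fixes X Y :: "'i \<Rightarrow> 'a \<Rightarrow> 'b::euclidean_space" and c :: "'i \<Rightarrow> real"
  assumes "I \<noteq> {}"
    and X: "indep_vars (\<lambda>_. borel) X I"
    and Y: "indep_vars (\<lambda>_. borel) Y I"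
    and id: "\<And>i. i \<in> I \<Longrightarrow> identically_distributed M (X i) (Y i)"
  shows "identically_distributed M (\<lambda>\<omega>. \<Sum>i\<in>I. c i *\<^sub>R X i \<omega>) (\<lambda>\<omega>. \<Sum>i\<in>I. c i *\<^sub>R Y i \<omega>)"
proof -
  let ?P = "PiM I (\<lambda>_. borel :: 'b measure)"
  let ?g = "\<lambda>x. \<Sum>i\<in>I. c i *\<^sub>R x i"
  have meas: "X i \<in> borel_measurable M" "Y i \<in> borel_measurable M" if "i \<in> I" for i
    using id[OF that] by (auto simp: identically_distributed_def)
  have g: "?g \<in> borel_measurable ?P" by measurable
  have pushforward: "distr M borel (\<lambda>\<omega>. ?g (\<lambda>i. Z i \<omega>)) =
      distr (PiM I (\<lambda>i. distr M borel (Z i))) borel ?g"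
    if Z: "indep_vars (\<lambda>_. borel) Z I" and Zm: "\<And>i. i \<in> I \<Longrightarrow> Z i \<in> borel_measurable M" for Z :: "'i \<Rightarrow> 'a \<Rightarrow> 'b"
  proof -
    have "distr M borel (\<lambda>\<omega>. ?g (\<lambda>i. Z i \<omega>)) = distr M borel (?g \<circ> (\<lambda>\<omega>. \<lambda>i\<in>I. Z i \<omega>))"
      by (rule arg_cong[where f = "distr M borel"]) (auto intro!: ext sum.cong)
    also have "\<dots> = distr (distr M ?P (\<lambda>\<omega>. \<lambda>i\<in>I. Z i \<omega>)) borel ?g"
      by (rule distr_distr[symmetric]) (use g Zm in \<open>auto intro!: measurable_restrict\<close>)
    also have "distr M ?P (\<lambda>\<omega>. \<lambda>i\<in>I. Z i \<omega>) = PiM I (\<lambda>i. distr M borel (Z i))"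
      using Z Zm indep_vars_iff_distr_eq_PiM'[OF \<open>I \<noteq> {}\<close>, of Z "\<lambda>_. borel"] by simp
    finally show ?thesis .
  qed
  have "PiM I (\<lambda>i. distr M borel (X i)) = PiM I (\<lambda>i. distr M borel (Y i))"
    using id by (intro PiM_cong) (auto simp: identically_distributed_def)
  then have "distr M borel (\<lambda>\<omega>. ?g (\<lambda>i. X i \<omega>)) = distr M borel (\<lambda>\<omega>. ?g (\<lambda>i. Y i \<omega>))"
    using pushforward[OF X meas(1)] pushforward[OF Y meas(2)] by simp
  then show ?thesis
    using meas by (auto simp: identically_distributed_def intro!: borel_measurable_sum)
qed

text \<open>
  Spherical and central symmetry are the instances in which \<open>f\<close> is orthogonal and in which \<open>f\<close> is
  negation.
\<close>

lemma (in prob_space) linear_combination_invariant: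
  fixes X :: "'i \<Rightarrow> 'a \<Rightarrow> 'b::euclidean_space" and c :: "'i \<Rightarrow> real" and \<mu> b :: 'b
  assumes "I \<noteq> {}"
    and indep: "indep_vars (\<lambda>_. borel) X I"
    and f: "linear f"
    and inv: "\<And>i. i \<in> I \<Longrightarrow> identically_distributed M (\<lambda>\<omega>. X i \<omega> - \<mu>) (\<lambda>\<omega>. f (X i \<omega> - \<mu>))"
  defines "S \<equiv> \<lambda>\<omega>. (\<Sum>i\<in>I. c i *\<^sub>R X i \<omega>) + b"
    and "m \<equiv> (\<Sum>i\<in>I. c i) *\<^sub>R \<mu> + b"
  shows "identically_distributed M (\<lambda>\<omega>. S \<omega> - m) (\<lambda>\<omega>. f (S \<omega> - m))"
proof -
  note f_meas [measurable] = borel_measurable_linear[OF f]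
  have centred: "S \<omega> - m = (\<Sum>i\<in>I. c i *\<^sub>R (X i \<omega> - \<mu>))" for \<omega>
    by (simp add: S_def m_def scaleR_diff_right sum_subtractf scaleR_left.sum)
  have "f (S \<omega> - m) = (\<Sum>i\<in>I. c i *\<^sub>R f (X i \<omega> - \<mu>))" for \<omega>
    unfolding centred by (simp add: linear_sum[OF f] linear_scale[OF f])
  moreover have "indep_vars (\<lambda>_. borel) (\<lambda>i \<omega>. X i \<omega> - \<mu>) I"
    by (rule indep_vars_compose2[OF indep]) measurable
  moreover have "indep_vars (\<lambda>_. borel) (\<lambda>i \<omega>. f (X i \<omega> - \<mu>)) I"
    by (rule indep_vars_compose2[OF indep]) measurable
  ultimately show ?thesis
    using identically_distributed_linear_combination[OF \<open>I \<noteq> {}\<close> _ _ inv, where c = c]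
    by (simp add: centred)
qed

lemma (in prob_space) spherically_symmetric_linear_combination:
  fixes X :: "'i \<Rightarrow> 'a \<Rightarrow> real ^ 'p" and c :: "'i \<Rightarrow> real"
  assumes "I \<noteq> {}"
    and "indep_vars (\<lambda>_. borel) X I"
    and "\<And>i. i \<in> I \<Longrightarrow> spherically_symmetric M (X i) \<mu>"
  shows "spherically_symmetric M (\<lambda>\<omega>. (\<Sum>i\<in>I. c i *\<^sub>R X i \<omega>) + b) ((\<Sum>i\<in>I. c i) *\<^sub>R \<mu> + b)"
  unfolding spherically_symmetric_def
  by (intro allI impI linear_combination_invariant assms matrix_vector_mul_linear)
    (use assms(3) in \<open>auto simp: spherically_symmetric_def\<close>)

lemma (in prob_space) centrally_symmetric_linear_combination:
  fixes X :: "'i \<Rightarrow> 'a \<Rightarrow> real ^ 'p" and c :: "'i \<Rightarrow> real"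
  assumes "I \<noteq> {}"
    and "indep_vars (\<lambda>_. borel) X I"
    and "\<And>i. i \<in> I \<Longrightarrow> centrally_symmetric M (X i) \<mu>"
  shows "centrally_symmetric M (\<lambda>\<omega>. (\<Sum>i\<in>I. c i *\<^sub>R X i \<omega>) + b) ((\<Sum>i\<in>I. c i) *\<^sub>R \<mu> + b)"
  using linear_combination_invariant[OF assms(1,2), where f = uminus and \<mu> = \<mu> and c = c and b = b]
    assms(3)
  by (simp add: centrally_symmetric_def module_hom_uminus linear_uminus)

lemma spherically_symmetric_transfer:
  fixes X Y :: "'s \<Rightarrow> real ^ 'p"
  assumes id: "identically_distributed M X Y" and sph: "spherically_symmetric M X \<mu>"
  shows "spherically_symmetric M Y \<mu>"
  unfolding spherically_symmetric_def
proof (intro allI impI)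
  fix U :: "real ^ 'p ^ 'p"
  assume U: "orthogonal_matrix U"
  have [measurable]: "(*v) U \<in> borel_measurable borel"
    by (intro borel_measurable_linear matrix_vector_mul_linear)
  have "identically_distributed M (\<lambda>\<omega>. X \<omega> - \<mu>) (\<lambda>\<omega>. Y \<omega> - \<mu>)"
    by (rule identically_distributed_compose[OF id]) measurable
  moreover have "identically_distributed M (\<lambda>\<omega>. U *v (X \<omega> - \<mu>)) (\<lambda>\<omega>. U *v (Y \<omega> - \<mu>))"
    by (rule identically_distributed_compose[OF id]) measurable
  moreover have "identically_distributed M (\<lambda>\<omega>. X \<omega> - \<mu>) (\<lambda>\<omega>. U *v (X \<omega> - \<mu>))"
    using sph U by (auto simp: spherically_symmetric_def)
  ultimately show "identically_distributed M (\<lambda>\<omega>. Y \<omega> - \<mu>) (\<lambda>\<omega>. U *v (Y \<omega> - \<mu>))"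
    by (simp add: identically_distributed_def)
qed

text \<open>
  The identity of the laws is essential here: independent variables with elliptical symmetry for
  different matrices can have a sum that is not elliptically symmetric.
\<close>

lemma (in prob_space) elliptically_symmetric_linear_combination:
  fixes X :: "'i \<Rightarrow> 'a \<Rightarrow> real ^ 'p" and c :: "'i \<Rightarrow> real"
  assumes "I \<noteq> {}"
    and indep: "indep_vars (\<lambda>_. borel) X I"
    and id: "\<And>i j. i \<in> I \<Longrightarrow> j \<in> I \<Longrightarrow> identically_distributed M (X i) (X j)"
    and ell: "\<And>i. i \<in> I \<Longrightarrow> elliptically_symmetric M (X i) \<mu>"
  shows "elliptically_symmetric M (\<lambda>\<omega>. (\<Sum>i\<in>I. c i *\<^sub>R X i \<omega>) + b) ((\<Sum>i\<in>I. c i) *\<^sub>R \<mu> + b)"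
proof -
  obtain k where k: "k \<in> I" using \<open>I \<noteq> {}\<close> by blast
  obtain V :: "real ^ 'p ^ 'p" where V: "invertible V"
    and sph: "spherically_symmetric M (\<lambda>\<omega>. V *v X k \<omega>) (V *v \<mu>)"
    using ell[OF k] by (auto simp: elliptically_symmetric_def)
  have V_meas: "(*v) V \<in> borel_measurable borel"
    by (intro borel_measurable_linear matrix_vector_mul_linear)
  have "spherically_symmetric M (\<lambda>\<omega>. V *v X i \<omega>) (V *v \<mu>)" if "i \<in> I" for i
    using identically_distributed_compose[OF id[OF k that] V_meas] sph
    by (rule spherically_symmetric_transfer)
  moreover have "indep_vars (\<lambda>_. borel) (\<lambda>i \<omega>. V *v X i \<omega>) I"
    by (rule indep_vars_compose2[OF indep]) (rule V_meas)
  ultimately have "spherically_symmetric M (\<lambda>\<omega>. (\<Sum>i\<in>I. c i *\<^sub>R (V *v X i \<omega>)) + V *v b)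
      ((\<Sum>i\<in>I. c i) *\<^sub>R (V *v \<mu>) + V *v b)"
    using \<open>I \<noteq> {}\<close> by (intro spherically_symmetric_linear_combination)
  moreover have "(\<Sum>i\<in>I. c i *\<^sub>R (V *v X i \<omega>)) + V *v b = V *v ((\<Sum>i\<in>I. c i *\<^sub>R X i \<omega>) + b)" for \<omega>
    by (simp add: matrix_vector_right_distrib linear_sum[OF matrix_vector_mul_linear]
        matrix_vector_mult_scaleR)
  moreover have "(\<Sum>i\<in>I. c i) *\<^sub>R (V *v \<mu>) + V *v b = V *v ((\<Sum>i\<in>I. c i) *\<^sub>R \<mu> + b)"
    by (simp add: matrix_vector_right_distrib matrix_vector_mult_scaleR)
  ultimately show ?thesis
    using V by (auto simp: elliptically_symmetric_def)
qed

theorem proposition2: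
  fixes M :: "'s measure"
    and X :: "nat \<Rightarrow> 's \<Rightarrow> real ^ 'p"
    and \<mu> b :: "real ^ 'p"
    and lam :: "nat \<Rightarrow> real"
    and n :: nat
    and symmetric_about :: "('s \<Rightarrow> real ^ 'p) \<Rightarrow> real ^ 'p \<Rightarrow> bool"
  assumes "prob_space M"
    and "n \<ge> 1"
    and "prob_space.indep_vars M (\<lambda>_. borel) X {1..n}"
    and "\<forall>i\<in>{1..n}. \<forall>j\<in>{1..n}. identically_distributed M (X i) (X j)"
    and "symmetric_about \<in>
           {spherically_symmetric M, elliptically_symmetric M, centrally_symmetric M}"
    and "\<forall>i\<in>{1..n}. symmetric_about (X i) \<mu>"
  shows "symmetric_about (\<lambda>\<omega>. (\<Sum>i=1..n. lam i *\<^sub>R X i \<omega>) + b)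
           ((\<Sum>i=1..n. lam i) *\<^sub>R \<mu> + b)"
proof -
  interpret prob_space M by fact
  have ne: "{1..n} \<noteq> {}" using \<open>n \<ge> 1\<close> by simp
  note indep = assms(3) and sym = assms(6)
  consider "symmetric_about = spherically_symmetric M"
    | "symmetric_about = elliptically_symmetric M"
    | "symmetric_about = centrally_symmetric M"
    using assms(5) by blast
  then show ?thesis
  proof cases
    case 1
    with sym show ?thesis
      using spherically_symmetric_linear_combination[OF ne indep] by blast
  next
    case 2
    with sym assms(4) show ?thesis
      using elliptically_symmetric_linear_combination[OF ne indep] by blast
  next
    case 3
    with sym show ?thesis
      using centrally_symmetric_linear_combination[OF ne indep] by blast
  qed
qed

end
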